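(* Consider the nonsymmetric V-cycle hierarchy $(A_k,B_k,P_k,R_k,M_k)$ and the level-wise error propagation matrices $E_{k,+}$ (with $\nu_1=\nu_2=1$ smoothing steps) defined in the context. For every level $k=0,\dots,L-1$ let $$\alpha_k=\sup_{(I-\Pi_{A_k})e\ne0}\frac{\|(I-(M_k^{-1}A_k)^+)e\|_{B_k}^2-\|\Pi_{A_k}e\|_{B_k}^2}{\|(I-\Pi_{A_k})e\|_{B_k}^2}.$$ Assume that $\alpha_k\in[0,1)$ and $\|I-M_k^{-1}A_k\|_{B_k}<1$ for every $k=0,\dots,L-1$. Then, with $\alpha=\max_{k=0,\dots,L-1}\alpha_k$, the inequality $$\|(I-(M_k^{-1}A_k)^+)e\|_{B_k}^2\le \alpha\,\|(I-\Pi_{A_k})e\|_{B_k}^2+\|\Pi_{A_k}e\|_{B_k}^2$$ holds for all $k=0,\dots,L-1$ and all $e\in\mathbb{C}^{n_k}$, and $$\|E_{0,+}\|_B\le\alpha=1-\frac1{C_V},\qquad C_V=\max_{k=0,\dots,L-1}\ \sup_{e\ne0}\frac{\|(I-\Pi_{A_k})B_k^{-1}e\|_{B_k}^2}{\|e\|_{\widehat M_k^{-1}}^2}.$$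
   Context: For a Hermitian positive definite (HPD) matrix $G\in\mathbb{C}^{m\times m}$: $\|x\|_G=\sqrt{x^HGx}$, and for $C\in\mathbb{C}^{m\times m}$, $\|C\|_G=\sup_{x\ne0}\|Cx\|_G/\|x\|_G$. $\mathcal R(\cdot)$ denotes the range (column space). Hierarchy: let $A\in\mathbb{C}^{n\times n}$ be nonsingular, $B\in\mathbb{C}^{n\times n}$ HPD, $L\in\mathbb{N}$, and $n=n_0>n_1>\dots>n_L\ge 1$ integers. Set $A_0=A$, $B_0=B$. For $k=0,\dots,L-1$ let $R_k,P_k\in\mathbb{C}^{n_k\times n_{k+1}}$ have full column rank with $\mathcal R(P_k)=\mathcal R(B_k^{-1}A_k^HR_k)$, and set $A_{k+1}=R_k^HA_kP_k$, $B_{k+1}=P_k^HB_kP_k$ (then $A_{k+1}$ is nonsingular and $B_{k+1}$ is HPD). For $k=0,\dots,L-1$ put $\Pi_{A_k}=P_kA_{k+1}^{-1}R_k^HA_k$, and let $M_k^{-1}\in\mathbb{C}^{n_k\times n_k}$ be a nonsingular matrix (the smoother). On level $k$, $C^+=B_k^{-1}C^HB_k$ denotes the $B_k$-adjoint of $C\in\mathbb{C}^{n_k\times n_k}$. The matrix $\widehat M_k^{-1}$ is defined by $\widehat M_k^{-1}B_k=M_k^{-1}A_k+(M_k^{-1}A_k)^+-M_k^{-1}A_k(M_k^{-1}A_k)^+$; it is HPD when $\|I-M_k^{-1}A_k\|_{B_k}<1$. Error matrices: $E_{L,+}=0\in\mathbb{C}^{n_L\times n_L}$ and, for $k=L-1,\dots,0$,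 $$E_{k,+}=(I-(M_k^{-1}A_k)^+)\bigl(I-P_k(I-E_{k+1,+})A_{k+1}^{-1}R_k^HA_k\bigr)(I-M_k^{-1}A_k).$$ *)

theory Defs
  imports
    "HOL-Library.Extended_Real"
    "Jordan_Normal_Form.Gauss_Jordan_Elimination"
    "Jordan_Normal_Form.Schur_Decomposition"
    "Jordan_Normal_Form.DL_Rank"
begin

text \<open>Vectors and matrices are those of \<open>Jordan_Normal_Form\<close>, since the dimensions
  \<open>n\<^sub>0 > n\<^sub>1 > \<dots> > n\<^sub>L\<close> vary from level to level within one statement.\<close>

text \<open>Meaningful for invertible arguments only.\<close>

definition mat_inv :: "complex mat \<Rightarrow> complex mat" where
  "mat_inv C = the (mat_inverse C)"

text \<open>\<open>v \<bullet>c w = (\<Sum>i. v\<^sub>i * cnj w\<^sub>i)\<close>, so \<open>(G *\<^sub>v x) \<bullet>c x\<close> is \<open>x\<^sup>H G x\<close>. It is real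
  when \<open>G\<close> is Hermitian.\<close>

definition hpd :: "nat \<Rightarrow> complex mat \<Rightarrow> bool" where
  "hpd m G \<longleftrightarrow> G \<in> carrier_mat m m \<and> mat_adjoint G = G \<and>
     (\<forall>x \<in> carrier_vec m. x \<noteq> 0\<^sub>v m \<longrightarrow> 0 < Re ((G *\<^sub>v x) \<bullet>c x))"

definition vnorm :: "complex mat \<Rightarrow> complex vec \<Rightarrow> real" where
  "vnorm G x = sqrt (Re ((G *\<^sub>v x) \<bullet>c x))"

text \<open>All suprema below are taken in the extended reals, where they exist without any
  boundedness side condition.\<close>

definition mnorm :: "complex mat \<Rightarrow> complex mat \<Rightarrow> ereal" where
  "mnorm G C = (SUP x \<in> {x \<in> carrier_vec (dim_row G). x \<noteq> 0\<^sub>v (dim_row G)}.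
     ereal (vnorm G (C *\<^sub>v x) / vnorm G x))"

text \<open>The adjoint \<open>C\<^sup>+\<close> of \<open>C\<close> with respect to the inner product induced by \<open>G\<close>.\<close>

definition adj_wrt :: "complex mat \<Rightarrow> complex mat \<Rightarrow> complex mat" where
  "adj_wrt G C = mat_inv G * mat_adjoint C * G"

text \<open>\<open>Minv k\<close> is the smoother \<open>M\<^sub>k\<^sup>-\<^sup>1\<close>. Nonsingularity of \<open>A (Suc k)\<close> and positive
  definiteness of \<open>B (Suc k)\<close> follow from the assumptions.\<close>

locale vcycle_hierarchy =
  fixes L :: nat and n :: "nat \<Rightarrow> nat"
    and A B P R Minv :: "nat \<Rightarrow> complex mat"
  assumes levels: "1 \<le> L"
    and dim_decreasing: "\<And>k. k < L \<Longrightarrow> n (Suc k) < n k"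
    and dim_coarsest: "1 \<le> n L"
    and A0_carrier: "A 0 \<in> carrier_mat (n 0) (n 0)"
    and A0_nonsingular: "invertible_mat (A 0)"
    and B0_hpd: "hpd (n 0) (B 0)"
    and R_carrier: "\<And>k. k < L \<Longrightarrow> R k \<in> carrier_mat (n k) (n (Suc k))"
    and P_carrier: "\<And>k. k < L \<Longrightarrow> P k \<in> carrier_mat (n k) (n (Suc k))"
    and R_full_rank: "\<And>k. k < L \<Longrightarrow> vec_space.rank (n k) (R k) = n (Suc k)"
    and P_full_rank: "\<And>k. k < L \<Longrightarrow> vec_space.rank (n k) (P k) = n (Suc k)"
    and range_P: "\<And>k. k < L \<Longrightarrow> vec_space.col_space (n k) (P k) =
      vec_space.col_space (n k) (mat_inv (B k) * mat_adjoint (A k) * R k)"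
    and A_coarse: "\<And>k. k < L \<Longrightarrow> A (Suc k) = mat_adjoint (R k) * A k * P k"
    and B_coarse: "\<And>k. k < L \<Longrightarrow> B (Suc k) = mat_adjoint (P k) * B k * P k"
    and Minv_carrier: "\<And>k. k < L \<Longrightarrow> Minv k \<in> carrier_mat (n k) (n k)"
    and Minv_nonsingular: "\<And>k. k < L \<Longrightarrow> invertible_mat (Minv k)"

abbreviation id_like :: "complex mat \<Rightarrow> complex mat" where
  "id_like C \<equiv> 1\<^sub>m (dim_row C)"

definition coarse_proj ::
  "(nat \<Rightarrow> complex mat) \<Rightarrow> (nat \<Rightarrow> complex mat) \<Rightarrow> (nat \<Rightarrow> complex mat) \<Rightarrow> nat \<Rightarrow> complex mat" where
  "coarse_proj A P R k = P k * mat_inv (A (Suc k)) * mat_adjoint (R k) * A k"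

text \<open>\<open>(M\<^sub>k\<^sup>-\<^sup>1 A\<^sub>k)\<^sup>+\<close>, the adjoint with respect to \<open>B\<^sub>k\<close>.\<close>

definition prec_adj ::
  "(nat \<Rightarrow> complex mat) \<Rightarrow> (nat \<Rightarrow> complex mat) \<Rightarrow> (nat \<Rightarrow> complex mat) \<Rightarrow> nat \<Rightarrow> complex mat" where
  "prec_adj A B Minv k = adj_wrt (B k) (Minv k * A k)"

definition alpha_level ::
  "(nat \<Rightarrow> complex mat) \<Rightarrow> (nat \<Rightarrow> complex mat) \<Rightarrow> (nat \<Rightarrow> complex mat) \<Rightarrow> (nat \<Rightarrow> complex mat) \<Rightarrow>
   (nat \<Rightarrow> complex mat) \<Rightarrow> nat \<Rightarrow> ereal" where
  "alpha_level A B P R Minv k =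
    (SUP e \<in> {e \<in> carrier_vec (dim_row (A k)).
               (id_like (A k) - coarse_proj A P R k) *\<^sub>v e \<noteq> 0\<^sub>v (dim_row (A k))}.
      ereal (((vnorm (B k) ((id_like (A k) - prec_adj A B Minv k) *\<^sub>v e))\<^sup>2
               - (vnorm (B k) (coarse_proj A P R k *\<^sub>v e))\<^sup>2)
             / (vnorm (B k) ((id_like (A k) - coarse_proj A P R k) *\<^sub>v e))\<^sup>2))"

definition alpha_max ::
  "nat \<Rightarrow> (nat \<Rightarrow> complex mat) \<Rightarrow> (nat \<Rightarrow> complex mat) \<Rightarrow> (nat \<Rightarrow> complex mat) \<Rightarrow>
   (nat \<Rightarrow> complex mat) \<Rightarrow> (nat \<Rightarrow> complex mat) \<Rightarrow> ereal" where
  "alpha_max L A B P R Minv = Max (alpha_level A B P R Minv ` {..<L})"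

text \<open>\<open>M\<^sub>k\<close>-hat inverse, i.e. the equation
  \<open>mhat_inv * B = T + T\<^sup>+ - T * T\<^sup>+\<close> with \<open>T = M\<^sub>k\<^sup>-\<^sup>1 A\<^sub>k\<close>, solved for \<open>mhat_inv\<close>.\<close>

definition mhat_inv ::
  "(nat \<Rightarrow> complex mat) \<Rightarrow> (nat \<Rightarrow> complex mat) \<Rightarrow> (nat \<Rightarrow> complex mat) \<Rightarrow> nat \<Rightarrow> complex mat" where
  "mhat_inv A B Minv k =
    (Minv k * A k + prec_adj A B Minv k - Minv k * A k * prec_adj A B Minv k) * mat_inv (B k)"

definition C_V ::
  "nat \<Rightarrow> (nat \<Rightarrow> complex mat) \<Rightarrow> (nat \<Rightarrow> complex mat) \<Rightarrow> (nat \<Rightarrow> complex mat) \<Rightarrow>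
   (nat \<Rightarrow> complex mat) \<Rightarrow> (nat \<Rightarrow> complex mat) \<Rightarrow> ereal" where
  "C_V L A B P R Minv =
    Max ((\<lambda>k. SUP e \<in> {e \<in> carrier_vec (dim_row (A k)). e \<noteq> 0\<^sub>v (dim_row (A k))}.
      ereal ((vnorm (B k) ((id_like (A k) - coarse_proj A P R k) *\<^sub>v (mat_inv (B k) *\<^sub>v e)))\<^sup>2
             / (vnorm (mhat_inv A B Minv k) e)\<^sup>2)) ` {..<L})"

text \<open>\<open>E\<^sub>k\<^sub>,\<^sub>+\<close>, by recursion from the coarsest level \<open>L\<close> upwards.\<close>

function vcycle_err ::
  "nat \<Rightarrow> (nat \<Rightarrow> complex mat) \<Rightarrow> (nat \<Rightarrow> complex mat) \<Rightarrow> (nat \<Rightarrow> complex mat) \<Rightarrow>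
   (nat \<Rightarrow> complex mat) \<Rightarrow> (nat \<Rightarrow> complex mat) \<Rightarrow> nat \<Rightarrow> complex mat" where
  "vcycle_err L A B P R Minv k =
    (if k < L then
       (id_like (A k) - prec_adj A B Minv k)
       * (id_like (A k) - P k * (id_like (A (Suc k)) - vcycle_err L A B P R Minv (Suc k))
                          * mat_inv (A (Suc k)) * mat_adjoint (R k) * A k)
       * (id_like (A k) - Minv k * A k)
     else 0\<^sub>m (dim_row (A L)) (dim_row (A L)))"
  by auto
termination
  by (relation "measure (\<lambda>(L, A, B, P, R, Minv, k). L - k)") auto

declare vcycle_err.simps [simp del]

end

theory Submission
  imports Defs
begin

text \<open>Write \<open>T\<^sub>k = M\<^sub>k\<^sup>-\<^sup>1 A\<^sub>k\<close> and \<open>S\<^sub>k = I - T\<^sub>k\<close>. The condition on the ranges of \<open>P\<^sub>k\<close>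
  and \<open>B\<^sub>k\<^sup>-\<^sup>1 A\<^sub>k\<^sup>H R\<^sub>k\<close> makes \<open>\<Pi>\<^sub>k\<close> an orthogonal projection for the inner product of \<open>B\<^sub>k\<close>
  (\<open>range_P_orthogonal\<close>), which yields the Pythagorean identity. By the choice of \<open>B\<^sub>k\<^sub>+\<^sub>1\<close> the map
  \<open>P\<^sub>k\<close> is an isometry from level \<open>k + 1\<close> to level \<open>k\<close>, so an estimate on the coarse level
  can be read on the fine one.

  The smoothing inequality is the definition of \<open>\<alpha>\<^sub>k\<close> wherever \<open>(I - \<Pi>\<^sub>k) e \<noteq> 0\<close>; elsewhere it
  says that \<open>S\<^sub>k\<^sup>+\<close> is a contraction, as \<open>S\<^sub>k\<close> is.

  The norm of the error matrix is not itself propagated from level to level. What is propagated is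
  \<open>\<parallel>E\<^sub>k x\<parallel>\<^sup>2 \<le> \<alpha> Re \<langle>E\<^sub>k x, x\<rangle>\<close>. It is trivial for \<open>E\<^sub>L = 0\<close>, and \<open>error_step\<close> derives it on level
  \<open>k\<close> from level \<open>k + 1\<close>: the corrected error splits orthogonally into its part in the range of
  \<open>I - \<Pi>\<^sub>k\<close>, whose squared norm smoothing damps by \<open>\<alpha>\<close>, and its part in the range of \<open>P\<^sub>k\<close>, which the
  coarser levels have already damped. Completing the square turns it into
  \<open>\<parallel>E\<^sub>0 x\<parallel> \<le> \<alpha> \<parallel>x\<parallel>\<close> (\<open>vnorm_le_of_rip\<close>).

  For the formula with \<open>C\<^sub>V\<close>, the symmetrized smoother satisfies
  \<open>I - (T\<^sub>k + T\<^sub>k\<^sup>+ - T\<^sub>k T\<^sub>k\<^sup>+) = S\<^sub>k S\<^sub>k\<^sup>+\<close>. After the substitution \<open>e = B\<^sub>k f\<close> the quotient in \<open>C\<^sub>V\<close>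
  is therefore \<open>r / d\<close> with \<open>r = \<parallel>(I - \<Pi>\<^sub>k) f\<parallel>\<^sup>2\<close> and \<open>d = \<parallel>f\<parallel>\<^sup>2 - \<parallel>S\<^sub>k\<^sup>+ f\<parallel>\<^sup>2\<close>, while by
  Pythagoras the quotient in \<open>\<alpha>\<^sub>k\<close> is \<open>(r - d) / r = 1 - 1 / (r / d)\<close>. So
  \<open>\<alpha>\<^sub>k = 1 - 1 / C\<^sub>k\<close> on each level (\<open>SUP_quotient_duality\<close>), and both maxima are attained on
  the same level.\<close>

section \<open>Matrices, ranges and inverses\<close>

lemma mult_mat_vec_zero_right:
  "C \<in> carrier_mat m p \<Longrightarrow> C *\<^sub>v 0\<^sub>v p = (0\<^sub>v m :: complex vec)"
  by (intro eq_vecI) (auto simp: mult_mat_vec_def)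

lemma mat_adjoint_carrier [simp]:
  "C \<in> carrier_mat m p \<Longrightarrow> mat_adjoint C \<in> carrier_mat p m"
  by (auto simp: mat_adjoint_def)

lemma mat_adjoint_index:
  assumes "C \<in> carrier_mat m p" "i < p" "j < m"
  shows "mat_adjoint C $$ (i, j) = conjugate (C $$ (j, i))"
  using assms by (auto simp: mat_adjoint_def mat_of_rows_def)

lemma mat_adjoint_adjoint:
  assumes "C \<in> carrier_mat m p"
  shows "mat_adjoint (mat_adjoint C) = C"
proof -
  have C': "mat_adjoint C \<in> carrier_mat p m" by (rule mat_adjoint_carrier[OF assms])
  show ?thesis
    using carrier_matD[OF assms] carrier_matD[OF mat_adjoint_carrier[OF C']]
    by (intro eq_matI) (simp_all add: mat_adjoint_index[OF assms] mat_adjoint_index[OF C'])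
qed

lemma mat_adjoint_mult:
  fixes C D :: "complex mat"
  assumes C: "C \<in> carrier_mat m p" and D: "D \<in> carrier_mat p q"
  shows "mat_adjoint (C * D) = mat_adjoint D * mat_adjoint C"
proof (rule eq_matI)
  have CD: "C * D \<in> carrier_mat m q" using C D by simp
  note car = mat_adjoint_carrier[OF C] mat_adjoint_carrier[OF D] mat_adjoint_carrier[OF CD]
  show "dim_row (mat_adjoint (C * D)) = dim_row (mat_adjoint D * mat_adjoint C)"
    "dim_col (mat_adjoint (C * D)) = dim_col (mat_adjoint D * mat_adjoint C)"
    using car by auto
  fix i j
  assume "i < dim_row (mat_adjoint D * mat_adjoint C)" "j < dim_col (mat_adjoint D * mat_adjoint C)"
  then have ij: "i < q" "j < m" using car by auto
  then show "mat_adjoint (C * D) $$ (i, j) = (mat_adjoint D * mat_adjoint C) $$ (i, j)"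
    using carrier_matD[OF C] carrier_matD[OF D] carrier_matD[OF car(1)] carrier_matD[OF car(2)]
    by (simp add: mat_adjoint_index[OF CD] mat_adjoint_index[OF C] mat_adjoint_index[OF D]
        scalar_prod_def mult_ac)
qed

lemma cscalar_prod_mat_adjoint:
  fixes C :: "complex mat"
  assumes C: "C \<in> carrier_mat m p" and x: "x \<in> carrier_vec p" and y: "y \<in> carrier_vec m"
  shows "(C *\<^sub>v x) \<bullet>c y = x \<bullet>c (mat_adjoint C *\<^sub>v y)"
proof -
  have "(C *\<^sub>v x) \<bullet>c y = (\<Sum>i<m. (\<Sum>j<p. C $$ (i, j) * x $ j) * cnj (y $ i))"
    using C x y by (auto simp: scalar_prod_def atLeast0LessThan intro!: sum.cong)
  also have "\<dots> = (\<Sum>i<m. \<Sum>j<p. x $ j * (C $$ (i, j) * cnj (y $ i)))"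
    by (simp add: sum_distrib_right sum_distrib_left mult_ac)
  also have "\<dots> = (\<Sum>j<p. \<Sum>i<m. x $ j * (C $$ (i, j) * cnj (y $ i)))"
    by (rule sum.swap)
  also have "\<dots> = (\<Sum>j<p. x $ j * cnj (\<Sum>i<m. mat_adjoint C $$ (j, i) * y $ i))"
    using C by (auto simp: sum_distrib_left mat_adjoint_index intro!: sum.cong)
  also have "\<dots> = x \<bullet>c (mat_adjoint C *\<^sub>v y)"
    using mat_adjoint_carrier[OF C] x y
    by (auto simp: scalar_prod_def atLeast0LessThan intro!: sum.cong)
  finally show ?thesis .
qed

lemma cscalar_prod_swap:
  fixes x y :: "complex vec"
  assumes "x \<in> carrier_vec m" "y \<in> carrier_vec m"
  shows "x \<bullet>c y = cnj (y \<bullet>c x)"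
  using assms by (auto simp: scalar_prod_def mult_ac)

text \<open>For a rectangular matrix the columns could repeat; but repeated columns already make
  the rank drop, so full column rank gives linearly independent columns.\<close>

lemma full_column_rank_injective:
  fixes C :: "complex mat"
  assumes C: "C \<in> carrier_mat m p" and rank: "vec_space.rank m C = p"
    and w: "w \<in> carrier_vec p" and zero: "C *\<^sub>v w = 0\<^sub>v m"
  shows "w = 0\<^sub>v p"
proof (rule ccontr)
  assume nz: "w \<noteq> 0\<^sub>v p"
  interpret vec_space "TYPE(complex)" m .
  have dist: "distinct (cols C)"
  proof -
    let ?indpt = "\<lambda>T. T \<subseteq> set (cols C) \<and> lin_indpt T"
    have "?indpt {}" by (simp add: finite_lin_indpt2)
    then obtain S where S: "maximal S ?indpt"
      using maximal_exists_superset[of "set (cols C)" ?indpt "{}"] by auto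
    then have "card S \<le> card (set (cols C))" by (simp add: card_mono maximal_def)
    moreover have "card S = p" using rank_card_indpt[OF C S] rank by simp
    moreover have "length (cols C) = p" using C by simp
    ultimately show ?thesis
      by (metis card_distinct card_length order_antisym)
  qed
  show False
    using full_rank_lin_indpt[OF C rank dist] lin_depI[OF C w nz zero dist] by blast
qed

lemma col_space_iff:
  fixes C :: "complex mat"
  assumes "C \<in> carrier_mat m p"
  shows "y \<in> vec_space.col_space m C \<longleftrightarrow> (\<exists>x \<in> carrier_vec p. y = C *\<^sub>v x)"
proof -
  interpret vec_space "TYPE(complex)" m .
  show ?thesis
    using assms by (auto simp: col_space_eq[OF assms])
qed

lemma mat_inv_of_injective:
  assumes C: "C \<in> carrier_mat m m"
    and inj: "\<And>x. x \<in> carrier_vec m \<Longrightarrow> C *\<^sub>v x = 0\<^sub>v m \<Longrightarrow> x = 0\<^sub>v m"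
  shows "mat_inv C \<in> carrier_mat m m" "C * mat_inv C = 1\<^sub>m m" "mat_inv C * C = 1\<^sub>m m"
proof -
  have "det C \<noteq> 0"
    using det_0_iff_vec_prod_zero_field[OF C] inj by blast
  then have "C \<in> Units (ring_mat TYPE(complex) m ())"
    by (rule det_non_zero_imp_unit[OF C])
  then obtain D where "mat_inverse C = Some D"
    using mat_inverse(1)[OF C, of "()"] by (cases "mat_inverse C") auto
  then show "mat_inv C \<in> carrier_mat m m" "C * mat_inv C = 1\<^sub>m m" "mat_inv C * C = 1\<^sub>m m"
    using mat_inverse(2)[OF C] by (auto simp: mat_inv_def)
qed

section \<open>The inner product of a Hermitian positive definite matrix\<close>

text \<open>The real part of the Hermitian inner product is a real inner product with the same norm, and
  its symmetry makes complex conjugates disappear from the estimates.\<close>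

definition rip :: "complex mat \<Rightarrow> complex vec \<Rightarrow> complex vec \<Rightarrow> real" where
  "rip G x y = Re ((G *\<^sub>v x) \<bullet>c y)"

locale hpd_matrix =
  fixes m :: nat and G :: "complex mat"
  assumes hpd: "hpd m G"
begin

lemma carrier [simp]: "G \<in> carrier_mat m m"
  using hpd by (simp add: hpd_def)

lemma G_vec [simp]: "x \<in> carrier_vec m \<Longrightarrow> G *\<^sub>v x \<in> carrier_vec m"
  using mult_mat_vec_carrier[OF carrier] .

lemma dim_row_G [simp]: "dim_row G = m"
  using carrier by blast

lemma hermitian: "mat_adjoint G = G"
  using hpd by (simp add: hpd_def)

lemma rip_pos: "x \<in> carrier_vec m \<Longrightarrow> x \<noteq> 0\<^sub>v m \<Longrightarrow> 0 < rip G x x"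
  using hpd by (simp add: hpd_def rip_def)

lemma rip_zero [simp]: "y \<in> carrier_vec m \<Longrightarrow> rip G (0\<^sub>v m) y = 0"
  by (simp add: rip_def mult_mat_vec_zero_right[OF carrier])

lemma rip_nonneg: "x \<in> carrier_vec m \<Longrightarrow> 0 \<le> rip G x x"
  using rip_pos[of x] by (cases "x = 0\<^sub>v m") auto

lemma rip_sym:
  assumes x: "x \<in> carrier_vec m" and y: "y \<in> carrier_vec m"
  shows "rip G x y = rip G y x"
proof -
  have "(G *\<^sub>v x) \<bullet>c y = x \<bullet>c (G *\<^sub>v y)"
    using cscalar_prod_mat_adjoint[OF carrier x y] by (simp add: hermitian)
  also have "\<dots> = cnj ((G *\<^sub>v y) \<bullet>c x)"
    by (rule cscalar_prod_swap) (use x y in auto)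
  finally show ?thesis by (simp add: rip_def)
qed

lemma rip_add_left:
  assumes "x \<in> carrier_vec m" "y \<in> carrier_vec m" "z \<in> carrier_vec m"
  shows "rip G (x + y) z = rip G x z + rip G y z"
  using assms
  by (simp add: rip_def mult_add_distrib_mat_vec[OF carrier] add_scalar_prod_distrib[of _ m])

lemma rip_diff_left:
  assumes "x \<in> carrier_vec m" "y \<in> carrier_vec m" "z \<in> carrier_vec m"
  shows "rip G (x - y) z = rip G x z - rip G y z"
  using assms
  by (simp add: rip_def mult_minus_distrib_mat_vec[OF carrier] minus_scalar_prod_distrib[of _ m])

lemma rip_smult_left:
  assumes "x \<in> carrier_vec m" "z \<in> carrier_vec m"
  shows "rip G (complex_of_real c \<cdot>\<^sub>v x) z = c * rip G x z"
  using assms by (simp add: rip_def mult_mat_vec[OF carrier])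

lemma rip_add_right:
  assumes "x \<in> carrier_vec m" "y \<in> carrier_vec m" "z \<in> carrier_vec m"
  shows "rip G z (x + y) = rip G z x + rip G z y"
  using assms rip_add_left[OF assms] by (simp add: rip_sym[of z])

lemma rip_diff_right:
  assumes "x \<in> carrier_vec m" "y \<in> carrier_vec m" "z \<in> carrier_vec m"
  shows "rip G z (x - y) = rip G z x - rip G z y"
  using assms rip_diff_left[OF assms] by (simp add: rip_sym[of z])

lemma rip_smult_right:
  assumes "x \<in> carrier_vec m" "z \<in> carrier_vec m"
  shows "rip G z (complex_of_real c \<cdot>\<^sub>v x) = c * rip G z x"
  using assms rip_smult_left[OF assms] by (simp add: rip_sym[of z])

lemma vnorm_sq: "x \<in> carrier_vec m \<Longrightarrow> (vnorm G x)\<^sup>2 = rip G x x"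
  using rip_nonneg[of x] by (simp add: vnorm_def rip_def)

lemma vnorm_nonneg: "x \<in> carrier_vec m \<Longrightarrow> 0 \<le> vnorm G x"
  using rip_nonneg[of x] by (simp add: vnorm_def rip_def)

lemma vnorm_pos: "x \<in> carrier_vec m \<Longrightarrow> x \<noteq> 0\<^sub>v m \<Longrightarrow> 0 < vnorm G x"
  using rip_pos[of x] by (simp add: vnorm_def rip_def)

lemma rip_diff_diff:
  assumes "x \<in> carrier_vec m" "y \<in> carrier_vec m"
  shows "rip G (x - y) (x - y) = rip G x x - 2 * rip G x y + rip G y y"
  using assms by (simp add: rip_diff_left rip_diff_right rip_sym[of y x])

lemma rip_add_add_orthogonal:
  assumes "x \<in> carrier_vec m" "y \<in> carrier_vec m" "rip G x y = 0"
  shows "rip G (x + y) (x + y) = rip G x x + rip G y y"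
  using assms by (simp add: rip_add_left rip_add_right rip_sym[of y x])

lemma inv_facts:
  "mat_inv G \<in> carrier_mat m m" "G * mat_inv G = 1\<^sub>m m" "mat_inv G * G = 1\<^sub>m m"
proof -
  have inj: "x = 0\<^sub>v m" if "x \<in> carrier_vec m" "G *\<^sub>v x = 0\<^sub>v m" for x
    using rip_pos[of x] that by (auto simp: rip_def)
  show "mat_inv G \<in> carrier_mat m m" "G * mat_inv G = 1\<^sub>m m" "mat_inv G * G = 1\<^sub>m m"
    by (rule mat_inv_of_injective[OF carrier], rule inj, assumption+)+
qed

lemma inv_carrier [simp]: "mat_inv G \<in> carrier_mat m m"
  by (rule inv_facts)

lemma inv_vec [simp]: "x \<in> carrier_vec m \<Longrightarrow> mat_inv G *\<^sub>v x \<in> carrier_vec m"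
  using mult_mat_vec_carrier[OF inv_carrier] .

lemma mult_inv_vec [simp]:
  assumes x: "x \<in> carrier_vec m"
  shows "G *\<^sub>v (mat_inv G *\<^sub>v x) = x" "mat_inv G *\<^sub>v (G *\<^sub>v x) = x"
  using x unfolding assoc_mult_mat_vec[OF carrier inv_carrier x, symmetric]
    assoc_mult_mat_vec[OF inv_carrier carrier x, symmetric] inv_facts(2,3)
  by simp_all

lemma adj_wrt_carrier [simp]: "C \<in> carrier_mat m m \<Longrightarrow> adj_wrt G C \<in> carrier_mat m m"
  unfolding adj_wrt_def
  by (rule mult_carrier_mat[OF mult_carrier_mat[OF inv_carrier mat_adjoint_carrier] carrier])

lemma adj_wrt_mult_vec [simp]:
  "C \<in> carrier_mat m m \<Longrightarrow> x \<in> carrier_vec m \<Longrightarrow> adj_wrt G C *\<^sub>v x \<in> carrier_vec m"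
  using mult_mat_vec_carrier[OF adj_wrt_carrier] .

lemma adj_wrt_vec:
  assumes C: "C \<in> carrier_mat m m" and x: "x \<in> carrier_vec m"
  shows "adj_wrt G C *\<^sub>v x = mat_inv G *\<^sub>v (mat_adjoint C *\<^sub>v (G *\<^sub>v x))"
proof -
  have C': "mat_adjoint C \<in> carrier_mat m m" using C by simp
  show ?thesis
    using x by (simp add: adj_wrt_def assoc_mult_mat_vec[OF mult_carrier_mat[OF inv_carrier C'] carrier]
        assoc_mult_mat_vec[OF inv_carrier C'])
qed

lemma rip_adj_wrt:
  assumes C: "C \<in> carrier_mat m m" and x: "x \<in> carrier_vec m" and y: "y \<in> carrier_vec m"
  shows "rip G (adj_wrt G C *\<^sub>v x) y = rip G x (C *\<^sub>v y)"
proof -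
  have Gx: "G *\<^sub>v x \<in> carrier_vec m" and Cy: "C *\<^sub>v y \<in> carrier_vec m"
    using C x y by auto
  have "(G *\<^sub>v (adj_wrt G C *\<^sub>v x)) \<bullet>c y = (mat_adjoint C *\<^sub>v (G *\<^sub>v x)) \<bullet>c y"
    using mat_adjoint_carrier[OF C] Gx by (simp add: adj_wrt_vec[OF C x])
  also have "\<dots> = cnj (y \<bullet>c (mat_adjoint C *\<^sub>v (G *\<^sub>v x)))"
    by (rule cscalar_prod_swap) (use mat_adjoint_carrier[OF C] Gx y in auto)
  also have "\<dots> = cnj ((C *\<^sub>v y) \<bullet>c (G *\<^sub>v x))"
    by (simp add: cscalar_prod_mat_adjoint[OF C y Gx])
  also have "\<dots> = (G *\<^sub>v x) \<bullet>c (C *\<^sub>v y)"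
    by (rule cscalar_prod_swap[symmetric]) (use Gx Cy in auto)
  finally show ?thesis by (simp add: rip_def)
qed

text \<open>Expanding \<open>0 \<le> \<parallel>y - a x\<parallel>\<^sup>2\<close> and bounding the cross term from below by the hypothesis leaves
  \<open>\<parallel>y\<parallel>\<^sup>2 \<le> a\<^sup>2 \<parallel>x\<parallel>\<^sup>2\<close>. With \<open>y = E\<^sub>k x\<close> the hypothesis is the estimate that passes from level to
  level.\<close>

lemma vnorm_le_of_rip:
  assumes x: "x \<in> carrier_vec m" and y: "y \<in> carrier_vec m" and a: "0 \<le> a"
    and le: "rip G y y \<le> a * rip G y x"
  shows "vnorm G y \<le> a * vnorm G x"
proof -
  let ?ax = "complex_of_real a \<cdot>\<^sub>v x"
  have ax: "?ax \<in> carrier_vec m" using x by simp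
  have "0 \<le> rip G (y - ?ax) (y - ?ax)"
    by (rule rip_nonneg) (use x y in auto)
  also have "\<dots> = rip G y y - 2 * (a * rip G y x) + a\<^sup>2 * rip G x x"
    using x y ax
    by (simp add: rip_diff_diff rip_smult_left rip_smult_right power2_eq_square)
  finally have "rip G y y \<le> a\<^sup>2 * rip G x x" using le by linarith
  then have "(vnorm G y)\<^sup>2 \<le> (a * vnorm G x)\<^sup>2"
    using x y by (simp add: vnorm_sq power_mult_distrib)
  then show ?thesis
    by (rule power2_le_imp_le) (use a vnorm_nonneg[OF x] in simp)
qed

lemma mnorm_lessD:
  assumes "mnorm G C < 1" "C \<in> carrier_mat m m" "x \<in> carrier_vec m" "x \<noteq> 0\<^sub>v m"
  shows "rip G (C *\<^sub>v x) (C *\<^sub>v x) < rip G x x"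
proof -
  have Cx: "C *\<^sub>v x \<in> carrier_vec m" using assms by auto
  have "ereal (vnorm G (C *\<^sub>v x) / vnorm G x) \<le> mnorm G C"
    unfolding mnorm_def by (rule SUP_upper) (use assms in auto)
  then have "ereal (vnorm G (C *\<^sub>v x) / vnorm G x) < 1"
    using assms(1) by (rule le_less_trans)
  then have "vnorm G (C *\<^sub>v x) < vnorm G x"
    using vnorm_pos[OF assms(3,4)] by simp
  then have "(vnorm G (C *\<^sub>v x))\<^sup>2 < (vnorm G x)\<^sup>2"
    using vnorm_nonneg[OF Cx] by (intro power_strict_mono) auto
  then show ?thesis using Cx assms by (simp add: vnorm_sq)
qed

lemma mnorm_leI:
  assumes "\<And>x. x \<in> carrier_vec m \<Longrightarrow> vnorm G (C *\<^sub>v x) \<le> a * vnorm G x"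
  shows "mnorm G C \<le> ereal a"
  unfolding mnorm_def
proof (rule SUP_least)
  fix x :: "complex vec" assume "x \<in> {x \<in> carrier_vec (dim_row G). x \<noteq> 0\<^sub>v (dim_row G)}"
  then show "ereal (vnorm G (C *\<^sub>v x) / vnorm G x) \<le> ereal a"
    using assms[of x] vnorm_pos[of x] by (simp add: divide_le_eq)
qed

end

section \<open>A duality between two suprema of quotients\<close>

text \<open>Since \<open>(r - d) / r = 1 - 1 / (r / d)\<close> is increasing in \<open>r / d\<close>, the two suprema
  are related in the same way. The points with \<open>r = 0\<close> contribute only the value \<open>0\<close> to the
  second one, and other points exist because the supremum of the empty set would be \<open>-\<infinity>\<close>,
  against \<open>0 \<le> \<alpha>\<close>.\<close>

lemma SUP_quotient_duality:
  fixes r d :: "'a \<Rightarrow> real"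
  assumes \<alpha>: "\<alpha> = (SUP x \<in> {x \<in> X. r x \<noteq> 0}. ereal ((r x - d x) / r x))"
    and r: "\<And>x. x \<in> X \<Longrightarrow> 0 \<le> r x" and d: "\<And>x. x \<in> X \<Longrightarrow> 0 < d x"
    and "0 \<le> \<alpha>" "\<alpha> < 1"
  shows "\<exists>a. 0 \<le> a \<and> a < 1 \<and> \<alpha> = ereal a \<and> (SUP x \<in> X. ereal (r x / d x)) = ereal (1 / (1 - a))"
proof -
  obtain a where a: "\<alpha> = ereal a" "0 \<le> a" "a < 1"
    using assms(4,5) by (cases \<alpha>) auto
  let ?C = "SUP x \<in> X. ereal (r x / d x)"
  have "?C \<le> ereal (1 / (1 - a))"
  proof (rule SUP_least)
    fix x assume x: "x \<in> X"
    show "ereal (r x / d x) \<le> ereal (1 / (1 - a))"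
    proof (cases "r x = 0")
      case True
      then show ?thesis using a by simp
    next
      case False
      have "ereal ((r x - d x) / r x) \<le> \<alpha>"
        unfolding \<alpha> by (rule SUP_upper) (use x False in auto)
      then have "(r x - d x) / r x \<le> a" by (simp add: a)
      then have "r x * (1 - a) \<le> d x"
        using False r[OF x] by (simp add: divide_le_eq algebra_simps split: if_splits)
      then show ?thesis using a d[OF x] by (simp add: field_simps)
    qed
  qed
  moreover have "ereal (1 / (1 - a)) \<le> ?C"
  proof (rule ccontr)
    assume "\<not> ereal (1 / (1 - a)) \<le> ?C"
    then have less: "?C < ereal (1 / (1 - a))" by simp
    have "{x \<in> X. r x \<noteq> 0} \<noteq> {}"
    proof
      assume "{x \<in> X. r x \<noteq> 0} = {}"
      then have "\<alpha> = bot" unfolding \<alpha> by (simp only: image_empty Sup_empty)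
      then show False using a by (simp add: bot_ereal_def)
    qed
    then obtain x0 where x0: "x0 \<in> X" "r x0 \<noteq> 0" by blast
    have "ereal (r x0 / d x0) \<le> ?C" by (rule SUP_upper) (use x0 in auto)
    moreover have "0 < r x0 / d x0"
      using r[OF x0(1)] x0 d[OF x0(1)] by (simp add: less_le)
    ultimately obtain c where c: "?C = ereal c" "0 < c"
      using less by (cases ?C) auto
    have "\<alpha> \<le> ereal (1 - 1 / c)"
      unfolding \<alpha>
    proof (rule SUP_least)
      fix x assume "x \<in> {x \<in> X. r x \<noteq> 0}"
      then have x: "x \<in> X" and rx: "0 < r x" using r[of x] by (auto simp: less_le)
      have "ereal (r x / d x) \<le> ?C" by (rule SUP_upper) (use x in auto)
      then have "r x / d x \<le> c" by (simp add: c)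
      then have "1 / c \<le> d x / r x" using d[OF x] rx c by (simp add: field_simps)
      then show "ereal ((r x - d x) / r x) \<le> ereal (1 - 1 / c)"
        using rx by (simp add: diff_divide_distrib)
    qed
    then have "a \<le> 1 - 1 / c" by (simp add: a)
    moreover have "c < 1 / (1 - a)" using less c by simp
    then have "1 - a < 1 / c" using a c by (simp add: field_simps)
    ultimately show False by simp
  qed
  ultimately show ?thesis using a by (intro exI[of _ a]) (simp add: order_antisym)
qed

section \<open>Smoothing\<close>

text \<open>\<open>T\<close> stands for \<open>M\<^sub>k\<^sup>-\<^sup>1 A\<^sub>k\<close>, so that \<open>S = I - T\<close> is the
  error propagation of one smoothing step.\<close>

locale smoother = hpd_matrix m G for m :: nat and G :: "complex mat" +
  fixes T :: "complex mat"
  assumes T_carrier [simp]: "T \<in> carrier_mat m m"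
    and contraction: "\<And>x. x \<in> carrier_vec m \<Longrightarrow> x \<noteq> 0\<^sub>v m \<Longrightarrow>
      rip G (x - T *\<^sub>v x) (x - T *\<^sub>v x) < rip G x x"
begin

lemma T_vec [simp]: "x \<in> carrier_vec m \<Longrightarrow> T *\<^sub>v x \<in> carrier_vec m"
  using mult_mat_vec_carrier[OF T_carrier] .

definition S :: "complex vec \<Rightarrow> complex vec" where
  "S x = x - T *\<^sub>v x"

definition S_adj :: "complex vec \<Rightarrow> complex vec" where
  "S_adj x = x - adj_wrt G T *\<^sub>v x"

lemma S_carrier [simp]: "x \<in> carrier_vec m \<Longrightarrow> S x \<in> carrier_vec m"
  by (simp add: S_def)

lemma S_adj_carrier [simp]: "x \<in> carrier_vec m \<Longrightarrow> S_adj x \<in> carrier_vec m"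
  by (simp add: S_adj_def)

lemma rip_S_adj:
  assumes "x \<in> carrier_vec m" "y \<in> carrier_vec m"
  shows "rip G (S_adj x) y = rip G x (S y)"
  using assms by (simp add: S_def S_adj_def rip_diff_left rip_diff_right rip_adj_wrt)

text \<open>Expanding \<open>0 \<le> \<parallel>x - S S\<^sup>+ x\<parallel>\<^sup>2\<close> gives
  \<open>2 \<parallel>S\<^sup>+ x\<parallel>\<^sup>2 \<le> \<parallel>x\<parallel>\<^sup>2 + \<parallel>S S\<^sup>+ x\<parallel>\<^sup>2\<close>, and \<open>\<parallel>S S\<^sup>+ x\<parallel> < \<parallel>S\<^sup>+ x\<parallel>\<close> unless \<open>S\<^sup>+ x = 0\<close>.\<close>

lemma S_adj_contraction:
  assumes x: "x \<in> carrier_vec m" "x \<noteq> 0\<^sub>v m"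
  shows "rip G (S_adj x) (S_adj x) < rip G x x"
proof (cases "S_adj x = 0\<^sub>v m")
  case True
  then show ?thesis using rip_pos[OF x] by simp
next
  case False
  let ?y = "S (S_adj x)"
  have "0 \<le> rip G (x - ?y) (x - ?y)"
    by (rule rip_nonneg) (use x in simp)
  also have "\<dots> = rip G x x - 2 * rip G (S_adj x) (S_adj x) + rip G ?y ?y"
    using x by (simp add: rip_diff_diff rip_S_adj)
  also have "rip G ?y ?y < rip G (S_adj x) (S_adj x)"
    using contraction[of "S_adj x"] x False by (simp add: S_def)
  finally show ?thesis by simp
qed

lemma S_adj_le:
  assumes x: "x \<in> carrier_vec m"
  shows "rip G (S_adj x) (S_adj x) \<le> rip G x x"
proof (cases "x = 0\<^sub>v m")
  case True
  have "adj_wrt G T *\<^sub>v 0\<^sub>v m = 0\<^sub>v m"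
    by (rule mult_mat_vec_zero_right) simp
  then show ?thesis using True by (simp add: S_adj_def)
next
  case False
  then show ?thesis using S_adj_contraction[OF x] by simp
qed

text \<open>The symmetrized smoother satisfies \<open>I - (T + T\<^sup>+ - T T\<^sup>+) = S S\<^sup>+\<close>.\<close>

lemma vnorm_symmetrized_smoother_sq:
  assumes x: "x \<in> carrier_vec m"
  shows "(vnorm ((T + adj_wrt G T - T * adj_wrt G T) * mat_inv G) (G *\<^sub>v x))\<^sup>2
    = rip G x x - rip G (S_adj x) (S_adj x)"
proof -
  let ?T' = "adj_wrt G T"
  let ?N = "T + ?T' - T * ?T'"
  have T': "?T' \<in> carrier_mat m m" by simp
  note TT' = mult_carrier_mat[OF T_carrier T']
  have N: "?N \<in> carrier_mat m m"
    by (rule minus_carrier_mat[OF TT'])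
  have T'x: "?T' *\<^sub>v x \<in> carrier_vec m"
    using x by simp
  have "?N *\<^sub>v x = (T *\<^sub>v x + ?T' *\<^sub>v x) - T *\<^sub>v (?T' *\<^sub>v x)"
    by (simp only: minus_mult_distrib_mat_vec[OF add_carrier_mat[OF T'] TT' x]
        add_mult_distrib_mat_vec[OF T_carrier T' x] assoc_mult_mat_vec[OF T_carrier T' x])
  also have "\<dots> = x - S (S_adj x)"
    unfolding S_def S_adj_def mult_minus_distrib_mat_vec[OF T_carrier x T'x]
    using carrier_vecD[OF x] carrier_vecD[OF T'x] carrier_vecD[OF T_vec[OF x]]
      carrier_vecD[OF T_vec[OF T'x]]
    by (intro eq_vecI) auto
  finally have Nx: "?N *\<^sub>v x = x - S (S_adj x)" .
  have Gx: "G *\<^sub>v x \<in> carrier_vec m" using x by simp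
  have "(?N * mat_inv G) *\<^sub>v (G *\<^sub>v x) = x - S (S_adj x)"
    using x by (simp add: assoc_mult_mat_vec[OF N inv_carrier Gx] Nx)
  then have "Re ((?N * mat_inv G *\<^sub>v (G *\<^sub>v x)) \<bullet>c (G *\<^sub>v x)) = Re ((x - S (S_adj x)) \<bullet>c (G *\<^sub>v x))"
    by simp
  also have "\<dots> = rip G x (x - S (S_adj x))"
    using cscalar_prod_swap[of "x - S (S_adj x)" m "G *\<^sub>v x"] x by (simp add: rip_def)
  also have "\<dots> = rip G x x - rip G (S_adj x) (S_adj x)"
    using x by (simp add: rip_diff_right rip_S_adj)
  finally have "Re ((?N * mat_inv G *\<^sub>v (G *\<^sub>v x)) \<bullet>c (G *\<^sub>v x))
    = rip G x x - rip G (S_adj x) (S_adj x)" .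
  then show ?thesis using S_adj_le[OF x] by (simp add: vnorm_def)
qed

end

section \<open>The coarse-grid correction\<close>

locale two_level = hpd_matrix m B for m :: nat and B :: "complex mat" +
  fixes p :: nat and A P R :: "complex mat"
  assumes A_mat [simp]: "A \<in> carrier_mat m m"
    and P_mat [simp]: "P \<in> carrier_mat m p"
    and R_mat [simp]: "R \<in> carrier_mat m p"
    and P_injective: "\<And>w. w \<in> carrier_vec p \<Longrightarrow> P *\<^sub>v w = 0\<^sub>v m \<Longrightarrow> w = 0\<^sub>v p"
    and P_range: "\<And>w. w \<in> carrier_vec p \<Longrightarrow>
      \<exists>v \<in> carrier_vec p. P *\<^sub>v w = (mat_inv B * mat_adjoint A * R) *\<^sub>v v"
begin

definition A_c :: "complex mat" where "A_c = mat_adjoint R * A * P"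
definition B_c :: "complex mat" where "B_c = mat_adjoint P * B * P"

text \<open>The matrix \<open>A\<^sub>c\<^sup>-\<^sup>1 R\<^sup>H A\<close>: it takes the error to the solution of the coarse residual
  equation, and is a left inverse of \<open>P\<close>.\<close>

definition coarse_solve :: "complex vec \<Rightarrow> complex vec" where
  "coarse_solve x = mat_inv A_c *\<^sub>v (mat_adjoint R *\<^sub>v (A *\<^sub>v x))"

definition proj :: "complex vec \<Rightarrow> complex vec" where
  "proj x = P *\<^sub>v coarse_solve x"

lemma R_adj_carrier [simp]: "mat_adjoint R \<in> carrier_mat p m"
  by simp

lemma P_adj_carrier [simp]: "mat_adjoint P \<in> carrier_mat p m"
  by simp

lemma A_adj_carrier [simp]: "mat_adjoint A \<in> carrier_mat m m"
  by simp

lemma mult_vec_carrier [simp]: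
  "x \<in> carrier_vec m \<Longrightarrow> A *\<^sub>v x \<in> carrier_vec m"
  "x \<in> carrier_vec m \<Longrightarrow> mat_adjoint A *\<^sub>v x \<in> carrier_vec m"
  "x \<in> carrier_vec m \<Longrightarrow> mat_adjoint R *\<^sub>v x \<in> carrier_vec p"
  "x \<in> carrier_vec m \<Longrightarrow> mat_adjoint P *\<^sub>v x \<in> carrier_vec p"
  "w \<in> carrier_vec p \<Longrightarrow> P *\<^sub>v w \<in> carrier_vec m"
  "w \<in> carrier_vec p \<Longrightarrow> R *\<^sub>v w \<in> carrier_vec m"
  using mult_mat_vec_carrier[OF A_mat] mult_mat_vec_carrier[OF A_adj_carrier]
    mult_mat_vec_carrier[OF R_adj_carrier] mult_mat_vec_carrier[OF P_adj_carrier]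
    mult_mat_vec_carrier[OF P_mat] mult_mat_vec_carrier[OF R_mat] by auto

lemma A_c_carrier [simp]: "A_c \<in> carrier_mat p p"
  unfolding A_c_def by (intro mult_carrier_mat[of _ p m]) auto

lemma B_c_carrier [simp]: "B_c \<in> carrier_mat p p"
  unfolding B_c_def by (intro mult_carrier_mat[of _ p m]) auto

lemma A_c_vec:
  "w \<in> carrier_vec p \<Longrightarrow> A_c *\<^sub>v w = mat_adjoint R *\<^sub>v (A *\<^sub>v (P *\<^sub>v w))"
  unfolding A_c_def
  by (simp add: assoc_mult_mat_vec[OF mult_carrier_mat[OF R_adj_carrier A_mat] P_mat]
    assoc_mult_mat_vec[OF R_adj_carrier A_mat])

lemma B_c_vec:
  "w \<in> carrier_vec p \<Longrightarrow> B_c *\<^sub>v w = mat_adjoint P *\<^sub>v (B *\<^sub>v (P *\<^sub>v w))"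
  unfolding B_c_def
  by (simp add: assoc_mult_mat_vec[OF mult_carrier_mat[OF P_adj_carrier carrier] P_mat]
    assoc_mult_mat_vec[OF P_adj_carrier carrier])

text \<open>The range of \<open>P\<close> lies in that of \<open>B\<^sup>-\<^sup>1 A\<^sup>H R\<close>, which is the
  orthogonal complement of the kernel of \<open>R\<^sup>H A\<close>: for
  \<open>P w = B\<^sup>-\<^sup>1 A\<^sup>H R v\<close> the inner product with \<open>y\<close> is \<open>v\<^sup>H (R\<^sup>H A y)\<close>.\<close>

lemma range_P_orthogonal:
  assumes y: "y \<in> carrier_vec m" and ker: "mat_adjoint R *\<^sub>v (A *\<^sub>v y) = 0\<^sub>v p"
    and w: "w \<in> carrier_vec p"
  shows "rip B (P *\<^sub>v w) y = 0"
proof -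
  obtain v where v: "v \<in> carrier_vec p" and Pw: "P *\<^sub>v w = (mat_inv B * mat_adjoint A * R) *\<^sub>v v"
    using P_range[OF w] by blast
  have Rv: "R *\<^sub>v v \<in> carrier_vec m" and A'Rv: "mat_adjoint A *\<^sub>v (R *\<^sub>v v) \<in> carrier_vec m"
    and Ay: "A *\<^sub>v y \<in> carrier_vec m"
    using v y by auto
  have "P *\<^sub>v w = mat_inv B *\<^sub>v (mat_adjoint A *\<^sub>v (R *\<^sub>v v))"
    using v Rv
    by (simp add: Pw assoc_mult_mat_vec[OF mult_carrier_mat[OF inv_carrier A_adj_carrier] R_mat]
        assoc_mult_mat_vec[OF inv_carrier A_adj_carrier])
  then have "(B *\<^sub>v (P *\<^sub>v w)) \<bullet>c y = (mat_adjoint A *\<^sub>v (R *\<^sub>v v)) \<bullet>c y"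
    using A'Rv by simp
  also have "\<dots> = cnj (y \<bullet>c (mat_adjoint A *\<^sub>v (R *\<^sub>v v)))"
    by (rule cscalar_prod_swap[OF A'Rv y])
  also have "\<dots> = cnj ((A *\<^sub>v y) \<bullet>c (R *\<^sub>v v))"
    by (simp add: cscalar_prod_mat_adjoint[OF A_mat y Rv])
  also have "\<dots> = (R *\<^sub>v v) \<bullet>c (A *\<^sub>v y)"
    by (rule cscalar_prod_swap[OF Rv Ay, symmetric])
  also have "\<dots> = v \<bullet>c (mat_adjoint R *\<^sub>v (A *\<^sub>v y))"
    by (rule cscalar_prod_mat_adjoint[OF R_mat v Ay])
  finally show ?thesis using v by (simp add: rip_def ker)
qed

text \<open>A kernel vector \<open>w\<close> of the coarse matrix makes \<open>P w\<close> lie in the kernel of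
  \<open>R\<^sup>H A\<close>, hence be orthogonal to itself; so \<open>P w = 0\<close>, and \<open>P\<close> is injective.\<close>

lemma A_c_inv:
  "mat_inv A_c \<in> carrier_mat p p" "A_c * mat_inv A_c = 1\<^sub>m p" "mat_inv A_c * A_c = 1\<^sub>m p"
proof -
  have inj: "w = 0\<^sub>v p" if w: "w \<in> carrier_vec p" and "A_c *\<^sub>v w = 0\<^sub>v p" for w
  proof (rule P_injective[OF w])
    have Pw: "P *\<^sub>v w \<in> carrier_vec m" using w by simp
    have "rip B (P *\<^sub>v w) (P *\<^sub>v w) = 0"
      using range_P_orthogonal[OF Pw _ w] that by (simp add: A_c_vec)
    then show "P *\<^sub>v w = 0\<^sub>v m" using rip_pos[OF Pw] by auto
  qed
  show "mat_inv A_c \<in> carrier_mat p p" "A_c * mat_inv A_c = 1\<^sub>m p" "mat_inv A_c * A_c = 1\<^sub>m p"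
    by (rule mat_inv_of_injective[OF A_c_carrier], rule inj, assumption+)+
qed

lemma A_c_inv_vec [simp]:
  assumes w: "w \<in> carrier_vec p"
  shows "A_c *\<^sub>v (mat_inv A_c *\<^sub>v w) = w" "mat_inv A_c *\<^sub>v (A_c *\<^sub>v w) = w"
  using w unfolding assoc_mult_mat_vec[OF A_c_carrier A_c_inv(1) w, symmetric]
    assoc_mult_mat_vec[OF A_c_inv(1) A_c_carrier w, symmetric] A_c_inv(2,3)
  by simp_all

lemma coarse_solve_carrier [simp]: "x \<in> carrier_vec m \<Longrightarrow> coarse_solve x \<in> carrier_vec p"
  unfolding coarse_solve_def by (rule mult_mat_vec_carrier[OF A_c_inv(1)]) simp

lemma proj_carrier [simp]: "x \<in> carrier_vec m \<Longrightarrow> proj x \<in> carrier_vec m"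
  by (simp add: proj_def)

lemma coarse_solve_P [simp]: "w \<in> carrier_vec p \<Longrightarrow> coarse_solve (P *\<^sub>v w) = w"
  by (simp add: coarse_solve_def flip: A_c_vec)

lemma coarse_solve_diff:
  assumes "x \<in> carrier_vec m" "y \<in> carrier_vec m"
  shows "coarse_solve (x - y) = coarse_solve x - coarse_solve y"
  using assms
  by (simp add: coarse_solve_def mult_minus_distrib_mat_vec[OF A_mat]
      mult_minus_distrib_mat_vec[OF R_adj_carrier] mult_minus_distrib_mat_vec[OF A_c_inv(1)])

lemma kernel_residual:
  assumes x: "x \<in> carrier_vec m"
  shows "mat_adjoint R *\<^sub>v (A *\<^sub>v (x - proj x)) = 0\<^sub>v p"
proof -
  have RAx: "mat_adjoint R *\<^sub>v (A *\<^sub>v x) \<in> carrier_vec p"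
    using x by simp
  have "mat_adjoint R *\<^sub>v (A *\<^sub>v (P *\<^sub>v coarse_solve x)) = A_c *\<^sub>v coarse_solve x"
    using x by (simp add: A_c_vec)
  also have "\<dots> = mat_adjoint R *\<^sub>v (A *\<^sub>v x)"
    using RAx by (simp add: coarse_solve_def)
  finally show ?thesis
    using x RAx
    by (simp add: proj_def mult_minus_distrib_mat_vec[OF A_mat]
        mult_minus_distrib_mat_vec[OF R_adj_carrier])
qed

lemma P_orthogonal_residual:
  "x \<in> carrier_vec m \<Longrightarrow> w \<in> carrier_vec p \<Longrightarrow> rip B (P *\<^sub>v w) (x - proj x) = 0"
  by (rule range_P_orthogonal) (auto simp: kernel_residual)

lemma proj_pythagoras:
  assumes x: "x \<in> carrier_vec m"
  shows "rip B x x = rip B (x - proj x) (x - proj x) + rip B (proj x) (proj x)"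
proof -
  have "x = (x - proj x) + proj x"
    by (intro eq_vecI) (simp_all add: carrier_vecD[OF x] carrier_vecD[OF proj_carrier[OF x]])
  moreover have "rip B (x - proj x) (proj x) = 0"
    using P_orthogonal_residual[OF x coarse_solve_carrier[OF x]] x rip_sym[of "x - proj x" "proj x"]
    by (simp add: proj_def[symmetric])
  ultimately show ?thesis
    using rip_add_add_orthogonal[of "x - proj x" "proj x"] x by simp
qed

lemma rip_B_c:
  assumes w: "w \<in> carrier_vec p" and v: "v \<in> carrier_vec p"
  shows "rip B_c w v = rip B (P *\<^sub>v w) (P *\<^sub>v v)"
proof -
  have P': "mat_adjoint P \<in> carrier_mat p m" by simp
  have Pw: "B *\<^sub>v (P *\<^sub>v w) \<in> carrier_vec m" using w by simp
  have "(B_c *\<^sub>v w) \<bullet>c v = cnj (v \<bullet>c (mat_adjoint P *\<^sub>v (B *\<^sub>v (P *\<^sub>v w))))"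
    using mult_mat_vec_carrier[OF P' Pw] v w by (simp add: B_c_vec cscalar_prod_swap[of _ p v])
  also have "\<dots> = cnj ((P *\<^sub>v v) \<bullet>c (B *\<^sub>v (P *\<^sub>v w)))"
    by (simp add: cscalar_prod_mat_adjoint[OF P_mat v Pw])
  also have "\<dots> = (B *\<^sub>v (P *\<^sub>v w)) \<bullet>c (P *\<^sub>v v)"
    by (rule cscalar_prod_swap[of _ m, symmetric]) (use v w in auto)
  finally show ?thesis by (simp add: rip_def)
qed

lemma hpd_B_c: "hpd p B_c"
  unfolding hpd_def
proof (intro conjI ballI impI)
  show "B_c \<in> carrier_mat p p" by simp
  show "mat_adjoint B_c = B_c"
  proof -
    have P': "mat_adjoint P \<in> carrier_mat p m" by simp
    have "mat_adjoint B_c = mat_adjoint P * (B * P)"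
      unfolding B_c_def
      by (simp add: mat_adjoint_mult[OF mult_carrier_mat[OF P' carrier] P_mat]
          mat_adjoint_mult[OF P' carrier] mat_adjoint_adjoint[OF P_mat] hermitian)
    then show ?thesis
      by (simp add: B_c_def assoc_mult_mat[OF P' carrier P_mat])
  qed
next
  fix w :: "complex vec" assume w: "w \<in> carrier_vec p" "w \<noteq> 0\<^sub>v p"
  then have "P *\<^sub>v w \<noteq> 0\<^sub>v m" using P_injective by blast
  then show "0 < Re ((B_c *\<^sub>v w) \<bullet>c w)"
    using rip_pos[of "P *\<^sub>v w"] rip_B_c[of w w] w by (simp add: rip_def)
qed

lemma coarse_factor_vec:
  assumes X: "X \<in> carrier_mat p p" and x: "x \<in> carrier_vec m"
  shows "(P * X * mat_inv A_c * mat_adjoint R * A) *\<^sub>v x = P *\<^sub>v (X *\<^sub>v coarse_solve x)"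
proof -
  note c1 = mult_carrier_mat[OF P_mat X]
  note c2 = mult_carrier_mat[OF c1 A_c_inv(1)]
  note c3 = mult_carrier_mat[OF c2 R_adj_carrier]
  have Ax: "A *\<^sub>v x \<in> carrier_vec m" and RAx: "mat_adjoint R *\<^sub>v (A *\<^sub>v x) \<in> carrier_vec p"
    using x by auto
  show ?thesis
    unfolding coarse_solve_def assoc_mult_mat_vec[OF c3 A_mat x]
      assoc_mult_mat_vec[OF c2 R_adj_carrier Ax] assoc_mult_mat_vec[OF c1 A_c_inv(1) RAx]
    by (rule assoc_mult_mat_vec[OF P_mat X mult_mat_vec_carrier[OF A_c_inv(1) RAx]])
qed

lemma proj_vec:
  assumes x: "x \<in> carrier_vec m"
  shows "(P * mat_inv A_c * mat_adjoint R * A) *\<^sub>v x = proj x"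
  using coarse_factor_vec[OF one_carrier_mat x] x
  by (simp add: right_mult_one_mat[OF P_mat] proj_def)

end

section \<open>One level of the V-cycle\<close>

locale smoothed_two_level = two_level m B p A P R + smoother m B T
  for m :: nat and B :: "complex mat" and p :: nat and A P R T :: "complex mat"
begin

definition alpha :: ereal where
  "alpha = (SUP e \<in> {e \<in> carrier_vec m. e - proj e \<noteq> 0\<^sub>v m}.
    ereal ((rip B (S_adj e) (S_adj e) - rip B (proj e) (proj e))
      / rip B (e - proj e) (e - proj e)))"

definition conv_const :: ereal where
  "conv_const = (SUP f \<in> {f \<in> carrier_vec m. f \<noteq> 0\<^sub>v m}.
    ereal (rip B (f - proj f) (f - proj f) / (rip B f f - rip B (S_adj f) (S_adj f))))"

text \<open>The supremum says nothing about the vectors fixed by the coarse projection; for them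
  the claim reads \<open>\<parallel>S\<^sup>+ e\<parallel> \<le> \<parallel>e\<parallel>\<close>.\<close>

lemma smoothing_estimate:
  assumes a: "alpha \<le> ereal a" and e: "e \<in> carrier_vec m"
  shows "rip B (S_adj e) (S_adj e) \<le> a * rip B (e - proj e) (e - proj e) + rip B (proj e) (proj e)"
proof (cases "e - proj e = 0\<^sub>v m")
  case True
  then have "rip B (e - proj e) (e - proj e) = 0" by simp
  then show ?thesis using S_adj_le[OF e] proj_pythagoras[OF e] by simp
next
  case False
  have pos: "0 < rip B (e - proj e) (e - proj e)"
    by (rule rip_pos) (use e False in auto)
  have "ereal ((rip B (S_adj e) (S_adj e) - rip B (proj e) (proj e))
      / rip B (e - proj e) (e - proj e)) \<le> alpha"
    unfolding alpha_def by (rule SUP_upper) (use e False in auto)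
  then have "ereal ((rip B (S_adj e) (S_adj e) - rip B (proj e) (proj e))
      / rip B (e - proj e) (e - proj e)) \<le> ereal a"
    using a by (rule order_trans)
  then show ?thesis using pos by (simp add: divide_le_eq)
qed

text \<open>With \<open>r = \<parallel>(I - \<Pi>) e\<parallel>\<^sup>2\<close> and \<open>d = \<parallel>e\<parallel>\<^sup>2 - \<parallel>S\<^sup>+ e\<parallel>\<^sup>2\<close> the Pythagorean identity rewrites
  the numerator of the first quotient as \<open>r - d\<close>, while the second quotient is \<open>r / d\<close>.\<close>

lemma alpha_eq_conv_const:
  assumes "0 \<le> alpha" "alpha < 1"
  shows "\<exists>a. 0 \<le> a \<and> a < 1 \<and> alpha = ereal a \<and> conv_const = ereal (1 / (1 - a))"
proof -
  let ?X = "{f \<in> carrier_vec m. f \<noteq> 0\<^sub>v m}"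
  let ?r = "\<lambda>e. rip B (e - proj e) (e - proj e)"
  let ?d = "\<lambda>e. rip B e e - rip B (S_adj e) (S_adj e)"
  \<comment> \<open>The zero vector is absent from the left set too, because it has \<open>r = 0\<close>.\<close>
  have dom: "{e \<in> carrier_vec m. e - proj e \<noteq> 0\<^sub>v m} = {e \<in> ?X. ?r e \<noteq> 0}"
  proof -
    have iff: "e - proj e \<noteq> 0\<^sub>v m \<longleftrightarrow> ?r e \<noteq> 0" if "e \<in> carrier_vec m" for e
      using rip_pos[of "e - proj e"] that by (cases "e - proj e = 0\<^sub>v m") auto
    have r0: "?r (0\<^sub>v m) = 0"
      using proj_pythagoras[of "0\<^sub>v m"] rip_nonneg[of "proj (0\<^sub>v m)"]
        rip_nonneg[of "0\<^sub>v m - proj (0\<^sub>v m)"] by simp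
    have nz: "e \<noteq> 0\<^sub>v m" if "?r e \<noteq> 0" for e
    proof
      assume "e = 0\<^sub>v m"
      with r0 that show False by (simp only:)
    qed
    show ?thesis
    proof (intro equalityI subsetI)
      fix e assume "e \<in> {e \<in> carrier_vec m. e - proj e \<noteq> 0\<^sub>v m}"
      then have e: "e \<in> carrier_vec m" "?r e \<noteq> 0" using iff by blast+
      then show "e \<in> {e \<in> ?X. ?r e \<noteq> 0}" using nz[OF e(2)] by blast
    next
      fix e assume "e \<in> {e \<in> ?X. ?r e \<noteq> 0}"
      then have "e \<in> carrier_vec m" "?r e \<noteq> 0" by blast+
      then show "e \<in> {e \<in> carrier_vec m. e - proj e \<noteq> 0\<^sub>v m}" using iff[of e] by blast
    qed
  qed
  have "alpha = (SUP e \<in> {e \<in> ?X. ?r e \<noteq> 0}. ereal ((?r e - ?d e) / ?r e))"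
    unfolding alpha_def dom
  proof (rule SUP_cong)
    fix e assume "e \<in> {e \<in> ?X. ?r e \<noteq> 0}"
    then have "e \<in> carrier_vec m" by blast
    from proj_pythagoras[OF this]
    have "rip B (S_adj e) (S_adj e) - rip B (proj e) (proj e) = ?r e - ?d e" by linarith
    then show "ereal ((rip B (S_adj e) (S_adj e) - rip B (proj e) (proj e)) / ?r e)
        = ereal ((?r e - ?d e) / ?r e)" by (simp only:)
  qed (rule refl)
  moreover have "0 \<le> ?r e" if "e \<in> ?X" for e
    by (rule rip_nonneg) (use that in auto)
  moreover have "0 < ?d e" if "e \<in> ?X" for e
    using S_adj_contraction[of e] that by auto
  ultimately show ?thesis
    unfolding conv_const_def using assms by (intro SUP_quotient_duality)
qed

text \<open>The reason for the convergence bound. With \<open>z = S x\<close> and \<open>Q = A\<^sub>c\<^sup>-\<^sup>1 R\<^sup>H A\<close> the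
  corrected error is \<open>y = (I - \<Pi>) z + P E' Q z\<close>, and the two summands are \<open>(I - \<Pi>) y\<close> and \<open>\<Pi> y\<close>.
  Since \<open>P\<close> is an isometry, \<open>\<Pi> = P Q\<close> and \<open>\<Pi>\<close> is an orthogonal projection, the smoothing
  estimate and the hypothesis on \<open>E'\<close> give, for the real inner product,
  \<open>\<parallel>S\<^sup>+ y\<parallel>\<^sup>2 \<le> a \<parallel>(I - \<Pi>) z\<parallel>\<^sup>2 + \<parallel>P E' Q z\<parallel>\<^sup>2
    \<le> a \<langle>(I - \<Pi>) z, z\<rangle> + a \<langle>P E' Q z, z\<rangle>
    = a \<langle>y, S x\<rangle> = a \<langle>S\<^sup>+ y, x\<rangle>\<close>, so the inequality reproduces itself.\<close>

lemma error_step: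
  assumes a: "alpha \<le> ereal a"
    and E'_carrier: "\<And>w. w \<in> carrier_vec p \<Longrightarrow> E' w \<in> carrier_vec p"
    and E': "\<And>w. w \<in> carrier_vec p \<Longrightarrow> rip B_c (E' w) (E' w) \<le> a * rip B_c (E' w) w"
    and x: "x \<in> carrier_vec m"
  defines "y \<equiv> S x - P *\<^sub>v (coarse_solve (S x) - E' (coarse_solve (S x)))"
  shows "rip B (S_adj y) (S_adj y) \<le> a * rip B (S_adj y) x"
proof -
  define z where "z = S x"
  define w where "w = coarse_solve z"
  define u where "u = P *\<^sub>v E' w"
  have z: "z \<in> carrier_vec m" using x by (simp add: z_def)
  have w: "w \<in> carrier_vec p" using z by (simp add: w_def)
  have E'w: "E' w \<in> carrier_vec p" using E'_carrier[OF w] .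
  have u: "u \<in> carrier_vec m" using E'w by (simp add: u_def)
  have zp: "z - proj z \<in> carrier_vec m" and pz: "proj z \<in> carrier_vec m" using z by auto
  have "y = z - (proj z - u)"
    unfolding y_def z_def[symmetric] w_def[symmetric] u_def proj_def
    by (simp add: mult_minus_distrib_mat_vec[OF P_mat w E'w])
  also have "\<dots> = (z - proj z) + u"
    by (intro eq_vecI)
      (simp_all add: carrier_vecD[OF z] carrier_vecD[OF pz] carrier_vecD[OF u])
  finally have y: "y = (z - proj z) + u" .
  have yc: "y \<in> carrier_vec m" using zp u by (simp add: y)
  have restr_y: "coarse_solve y = E' w"
  proof -
    have "coarse_solve y = w - (w - E' w)"
      unfolding y_def z_def[symmetric] w_def[symmetric] using z w E'w
      by (simp add: coarse_solve_diff w_def[symmetric])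
    also have "\<dots> = E' w"
      by (intro eq_vecI) (simp_all add: carrier_vecD[OF w] carrier_vecD[OF E'w])
    finally show ?thesis .
  qed
  then have proj_y: "proj y = u" by (simp add: proj_def u_def)
  have res_y: "y - proj y = z - proj z"
    unfolding proj_y unfolding y
    by (intro eq_vecI)
      (simp_all add: carrier_vecD[OF z] carrier_vecD[OF pz] carrier_vecD[OF u])
  have orth_u: "rip B u (z - proj z) = 0"
    unfolding u_def by (rule P_orthogonal_residual[OF z E'w])
  have orth_z: "rip B (z - proj z) (proj z) = 0"
    using P_orthogonal_residual[OF z w] rip_sym[OF zp pz] by (simp add: proj_def w_def)
  have "rip B (z - proj z) (z - proj z) = rip B (z - proj z) z"
    using orth_z by (simp add: rip_diff_right[OF z pz zp])
  moreover have "rip B u u \<le> a * rip B u z"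
  proof -
    have "rip B u (proj z) = rip B u z"
      using orth_u by (simp add: rip_diff_right[OF z pz u])
    then show ?thesis
      using E'[OF w] rip_B_c[OF E'w E'w] rip_B_c[OF E'w w] by (simp add: u_def proj_def w_def)
  qed
  ultimately have "rip B (S_adj y) (S_adj y) \<le> a * (rip B (z - proj z) z + rip B u z)"
    using smoothing_estimate[OF a yc, unfolded res_y, unfolded proj_y] by (simp add: distrib_left)
  also have "rip B (z - proj z) z + rip B u z = rip B y z"
    unfolding y by (rule rip_add_left[OF zp u z, symmetric])
  also have "\<dots> = rip B (S_adj y) x"
    unfolding z_def by (rule rip_S_adj[OF yc x, symmetric])
  finally show ?thesis .
qed

end

section \<open>The hierarchy\<close>

locale contracting_vcycle = vcycle_hierarchy L n A B P R Minv
  for L :: nat and n :: "nat \<Rightarrow> nat" and A B P R Minv :: "nat \<Rightarrow> complex mat" +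
  assumes smoother_norm: "\<And>k. k < L \<Longrightarrow> mnorm (B k) (1\<^sub>m (n k) - Minv k * A k) < 1"
begin

lemma two_level_at:
  assumes k: "k < L" and A: "A k \<in> carrier_mat (n k) (n k)" and B: "hpd (n k) (B k)"
  shows "two_level (n k) (B k) (n (Suc k)) (A k) (P k) (R k)"
proof -
  interpret hpd_matrix "n k" "B k" using B by unfold_locales
  show ?thesis
  proof
    show "A k \<in> carrier_mat (n k) (n k)" by (rule A)
    show "P k \<in> carrier_mat (n k) (n (Suc k))" by (rule P_carrier[OF k])
    show "R k \<in> carrier_mat (n k) (n (Suc k))" by (rule R_carrier[OF k])
    show "w = 0\<^sub>v (n (Suc k))"
      if "w \<in> carrier_vec (n (Suc k))" "P k *\<^sub>v w = 0\<^sub>v (n k)" for w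
      by (rule full_column_rank_injective[OF P_carrier[OF k] P_full_rank[OF k] that])
    fix w :: "complex vec" assume w: "w \<in> carrier_vec (n (Suc k))"
    have C: "mat_inv (B k) * mat_adjoint (A k) * R k \<in> carrier_mat (n k) (n (Suc k))"
      by (rule mult_carrier_mat[OF mult_carrier_mat[OF inv_carrier mat_adjoint_carrier[OF A]]
            R_carrier[OF k]])
    have "P k *\<^sub>v w \<in> vec_space.col_space (n k) (P k)"
      using w by (auto simp: col_space_iff[OF P_carrier[OF k]])
    then show "\<exists>v \<in> carrier_vec (n (Suc k)).
        P k *\<^sub>v w = mat_inv (B k) * mat_adjoint (A k) * R k *\<^sub>v v"
      by (simp add: range_P[OF k] col_space_iff[OF C])
  qed
qed

lemma level_facts:
  "k \<le> L \<Longrightarrow> A k \<in> carrier_mat (n k) (n k) \<and> hpd (n k) (B k)"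
proof (induction k)
  case 0
  then show ?case using A0_carrier B0_hpd by simp
next
  case (Suc k)
  then have k: "k < L" by simp
  interpret two_level "n k" "B k" "n (Suc k)" "A k" "P k" "R k"
    using two_level_at[OF k] Suc by simp
  show ?case
    using A_c_carrier hpd_B_c by (simp add: A_coarse[OF k] B_coarse[OF k] A_c_def B_c_def)
qed

lemma level_at:
  assumes k: "k < L"
  shows "smoothed_two_level (n k) (B k) (n (Suc k)) (A k) (P k) (R k) (Minv k * A k)"
proof -
  interpret two_level "n k" "B k" "n (Suc k)" "A k" "P k" "R k"
    using two_level_at[OF k] level_facts[of k] k by simp
  have T: "Minv k * A k \<in> carrier_mat (n k) (n k)"
    by (rule mult_carrier_mat[OF Minv_carrier[OF k] A_mat])
  show ?thesis
  proof
    show "Minv k * A k \<in> carrier_mat (n k) (n k)" by (rule T)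
    fix x :: "complex vec" assume x: "x \<in> carrier_vec (n k)" "x \<noteq> 0\<^sub>v (n k)"
    have "(1\<^sub>m (n k) - Minv k * A k) *\<^sub>v x = x - (Minv k * A k) *\<^sub>v x"
      using x(1) unfolding minus_mult_distrib_mat_vec[OF one_carrier_mat T x(1)] by simp
    then show "rip (B k) (x - (Minv k * A k) *\<^sub>v x) (x - (Minv k * A k) *\<^sub>v x) < rip (B k) x x"
      using mnorm_lessD[OF smoother_norm[OF k] minus_carrier_mat[OF T] x] by simp
  qed
qed

lemma A_Suc: "k < L \<Longrightarrow> A (Suc k) = two_level.A_c (A k) (P k) (R k)"
proof -
  assume k: "k < L"
  interpret smoothed_two_level "n k" "B k" "n (Suc k)" "A k" "P k" "R k" "Minv k * A k"
    by (rule level_at[OF k])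
  show ?thesis by (simp add: A_coarse[OF k] A_c_def)
qed

lemma B_Suc: "k < L \<Longrightarrow> B (Suc k) = two_level.B_c (B k) (P k)"
proof -
  assume k: "k < L"
  interpret smoothed_two_level "n k" "B k" "n (Suc k)" "A k" "P k" "R k" "Minv k * A k"
    by (rule level_at[OF k])
  show ?thesis by (simp add: B_coarse[OF k] B_c_def)
qed

lemma coarse_proj_vec:
  assumes k: "k < L" and x: "x \<in> carrier_vec (n k)"
  shows "coarse_proj A P R k *\<^sub>v x = two_level.proj (A k) (P k) (R k) x"
proof -
  interpret smoothed_two_level "n k" "B k" "n (Suc k)" "A k" "P k" "R k" "Minv k * A k"
    by (rule level_at[OF k])
  show ?thesis using proj_vec[OF x] by (simp add: coarse_proj_def A_Suc[OF k])
qed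

lemma residual_vec:
  assumes k: "k < L" and x: "x \<in> carrier_vec (n k)"
  shows "(1\<^sub>m (n k) - coarse_proj A P R k) *\<^sub>v x = x - two_level.proj (A k) (P k) (R k) x"
proof -
  interpret smoothed_two_level "n k" "B k" "n (Suc k)" "A k" "P k" "R k" "Minv k * A k"
    by (rule level_at[OF k])
  have "coarse_proj A P R k \<in> carrier_mat (n k) (n k)"
    unfolding coarse_proj_def A_Suc[OF k]
    by (rule mult_carrier_mat[OF mult_carrier_mat[OF mult_carrier_mat[OF
            P_carrier[OF k] A_c_inv(1)] R_adj_carrier] A_mat])
  from minus_mult_distrib_mat_vec[OF one_carrier_mat this x] show ?thesis
    using x by (simp add: coarse_proj_vec[OF k x])
qed

lemma S_adj_vec:
  assumes k: "k < L" and x: "x \<in> carrier_vec (n k)"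
  shows "(1\<^sub>m (n k) - adj_wrt (B k) (Minv k * A k)) *\<^sub>v x
    = smoother.S_adj (B k) (Minv k * A k) x"
proof -
  interpret smoothed_two_level "n k" "B k" "n (Suc k)" "A k" "P k" "R k" "Minv k * A k"
    by (rule level_at[OF k])
  show ?thesis
    using minus_mult_distrib_mat_vec[OF one_carrier_mat adj_wrt_carrier[OF T_carrier] x] x
    by (simp add: S_adj_def)
qed

lemma alpha_level_eq:
  assumes k: "k < L"
  shows "alpha_level A B P R Minv k
    = smoothed_two_level.alpha (n k) (B k) (A k) (P k) (R k) (Minv k * A k)"
proof -
  interpret smoothed_two_level "n k" "B k" "n (Suc k)" "A k" "P k" "R k" "Minv k * A k"
    by (rule level_at[OF k])
  have dim: "dim_row (A k) = n k" using A_mat by blast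
  show ?thesis
    unfolding alpha_level_def alpha_def prec_adj_def dim
    by (rule SUP_cong)
      (auto simp: residual_vec[OF k] coarse_proj_vec[OF k] S_adj_vec[OF k] vnorm_sq)
qed

text \<open>Substituting \<open>e = B f\<close> turns the norm of the symmetrized smoother into
  \<open>\<parallel>f\<parallel>\<^sup>2 - \<parallel>S\<^sup>+ f\<parallel>\<^sup>2\<close>.\<close>

lemma conv_const_eq:
  assumes k: "k < L"
  shows "(SUP e \<in> {e \<in> carrier_vec (dim_row (A k)). e \<noteq> 0\<^sub>v (dim_row (A k))}.
      ereal ((vnorm (B k) ((id_like (A k) - coarse_proj A P R k) *\<^sub>v (mat_inv (B k) *\<^sub>v e)))\<^sup>2
             / (vnorm (mhat_inv A B Minv k) e)\<^sup>2))
    = smoothed_two_level.conv_const (n k) (B k) (A k) (P k) (R k) (Minv k * A k)"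
proof -
  interpret smoothed_two_level "n k" "B k" "n (Suc k)" "A k" "P k" "R k" "Minv k * A k"
    by (rule level_at[OF k])
  have dim: "dim_row (A k) = n k" using A_mat by blast
  have B0: "B k *\<^sub>v 0\<^sub>v (n k) = 0\<^sub>v (n k)" "mat_inv (B k) *\<^sub>v 0\<^sub>v (n k) = 0\<^sub>v (n k)"
    by (rule mult_mat_vec_zero_right[OF carrier], rule mult_mat_vec_zero_right[OF inv_carrier])
  have img: "{e \<in> carrier_vec (n k). e \<noteq> 0\<^sub>v (n k)}
    = (\<lambda>f. B k *\<^sub>v f) ` {f \<in> carrier_vec (n k). f \<noteq> 0\<^sub>v (n k)}" (is "?X = _")
  proof (intro equalityI subsetI)
    fix e assume "e \<in> ?X"
    then have e: "e \<in> carrier_vec (n k)" "e \<noteq> 0\<^sub>v (n k)" by auto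
    then have "mat_inv (B k) *\<^sub>v e \<noteq> 0\<^sub>v (n k)"
      using mult_inv_vec(1)[OF e(1)] B0(1) by metis
    then show "e \<in> (\<lambda>f. B k *\<^sub>v f) ` ?X"
      using e by (intro image_eqI[of _ _ "mat_inv (B k) *\<^sub>v e"]) auto
  next
    fix e assume "e \<in> (\<lambda>f. B k *\<^sub>v f) ` ?X"
    then obtain f where f: "f \<in> carrier_vec (n k)" "f \<noteq> 0\<^sub>v (n k)" "e = B k *\<^sub>v f" by auto
    then have "B k *\<^sub>v f \<noteq> 0\<^sub>v (n k)"
      using mult_inv_vec(2)[OF f(1)] B0(2) by metis
    then show "e \<in> ?X" using f by auto
  qed
  show ?thesis
    unfolding conv_const_def dim mhat_inv_def prec_adj_def
    by (subst img, subst image_image, intro SUP_cong refl)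
      (auto simp: residual_vec[OF k] vnorm_sq vnorm_symmetrized_smoother_sq)
qed

lemma vcycle_err_top: "vcycle_err L A B P R Minv L = 0\<^sub>m (n L) (n L)"
  using level_facts[of L] by (subst vcycle_err.simps) auto

lemma vcycle_err_carrier:
  "k \<le> L \<Longrightarrow> vcycle_err L A B P R Minv k \<in> carrier_mat (n k) (n k)"
proof -
  assume "k \<le> L"
  then consider "k = L" | "k < L" by linarith
  then show ?thesis
  proof cases
    case 1
    then show ?thesis by (simp add: vcycle_err_top)
  next
    case 2
    interpret smoothed_two_level "n k" "B k" "n (Suc k)" "A k" "P k" "R k" "Minv k * A k"
      by (rule level_at[OF 2])
    have dim: "dim_row (A k) = n k" using A_mat by blast
    show ?thesis
      using 2 carrier_matD[OF A_mat] carrier_matD[OF T_carrier]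
        carrier_matD[OF adj_wrt_carrier[OF T_carrier]]
      by (subst vcycle_err.simps)
        (auto intro!: carrier_matI simp: dim prec_adj_def)
  qed
qed

lemma vcycle_err_vec:
  assumes k: "k < L" and x: "x \<in> carrier_vec (n k)"
  defines "w \<equiv> two_level.coarse_solve (A k) (P k) (R k) (smoother.S (Minv k * A k) x)"
  shows "vcycle_err L A B P R Minv k *\<^sub>v x
    = smoother.S_adj (B k) (Minv k * A k) (smoother.S (Minv k * A k) x
        - P k *\<^sub>v (w - vcycle_err L A B P R Minv (Suc k) *\<^sub>v w))"
proof -
  interpret smoothed_two_level "n k" "B k" "n (Suc k)" "A k" "P k" "R k" "Minv k * A k"
    by (rule level_at[OF k])
  let ?E = "vcycle_err L A B P R Minv (Suc k)" and ?p = "n (Suc k)" and ?m = "n k"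
  have E: "?E \<in> carrier_mat ?p ?p"
    using vcycle_err_carrier[of "Suc k"] k by simp
  have dim: "dim_row (A k) = ?m" "dim_row (A (Suc k)) = ?p"
    using carrier_matD(1)[OF A_mat] level_facts[of "Suc k"] k by auto
  let ?X = "1\<^sub>m ?p - ?E"
  let ?C = "P k * ?X * mat_inv A_c * mat_adjoint (R k) * A k"
  let ?S' = "1\<^sub>m ?m - adj_wrt (B k) (Minv k * A k)" and ?S = "1\<^sub>m ?m - Minv k * A k"
  have X: "?X \<in> carrier_mat ?p ?p" by (rule minus_carrier_mat[OF E])
  have C: "?C \<in> carrier_mat ?m ?m"
    by (rule mult_carrier_mat[OF mult_carrier_mat[OF mult_carrier_mat[OF mult_carrier_mat[OF
            P_carrier[OF k] X] A_c_inv(1)] R_adj_carrier] A_mat])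
  have C1: "1\<^sub>m ?m - ?C \<in> carrier_mat ?m ?m" by (rule minus_carrier_mat[OF C])
  have S': "?S' \<in> carrier_mat ?m ?m" by (rule minus_carrier_mat) simp
  have S: "?S \<in> carrier_mat ?m ?m" by (rule minus_carrier_mat) simp
  have Sx: "?S *\<^sub>v x = S x"
    using minus_mult_distrib_mat_vec[OF one_carrier_mat T_carrier x] x by (simp add: S_def)
  have z: "S x \<in> carrier_vec ?m" using x by simp
  have w: "w \<in> carrier_vec ?p" using z by (simp add: w_def)
  have "vcycle_err L A B P R Minv k = ?S' * (1\<^sub>m ?m - ?C) * ?S"
    using k by (subst vcycle_err.simps) (simp add: prec_adj_def dim A_Suc carrier_matD(1)[OF A_c_carrier])
  then have "vcycle_err L A B P R Minv k *\<^sub>v x = ?S' *\<^sub>v ((1\<^sub>m ?m - ?C) *\<^sub>v S x)"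
    by (simp only: assoc_mult_mat_vec[OF mult_carrier_mat[OF S' C1] S x] Sx
        assoc_mult_mat_vec[OF S' C1 z])
  also have "(1\<^sub>m ?m - ?C) *\<^sub>v S x = S x - P k *\<^sub>v (?X *\<^sub>v w)"
    unfolding minus_mult_distrib_mat_vec[OF one_carrier_mat C z] coarse_factor_vec[OF X z] w_def
    using z by simp
  also have "?X *\<^sub>v w = w - ?E *\<^sub>v w"
    unfolding minus_mult_distrib_mat_vec[OF one_carrier_mat E w] using w by simp
  also have "?S' *\<^sub>v (S x - P k *\<^sub>v (w - ?E *\<^sub>v w)) = S_adj (S x - P k *\<^sub>v (w - ?E *\<^sub>v w))"
    by (rule S_adj_vec[OF k])
      (use z mult_mat_vec_carrier[OF P_carrier[OF k] minus_carrier_vec[OF w mult_mat_vec_carrier[OF E w]]] in simp)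
  finally show ?thesis .
qed

text \<open>The induction runs from the coarsest level, where the error matrix vanishes, upwards.\<close>

lemma vcycle_err_estimate:
  assumes a: "\<And>k. k < L \<Longrightarrow> alpha_level A B P R Minv k \<le> ereal a"
    and "k \<le> L" "x \<in> carrier_vec (n k)"
  shows "rip (B k) (vcycle_err L A B P R Minv k *\<^sub>v x) (vcycle_err L A B P R Minv k *\<^sub>v x)
    \<le> a * rip (B k) (vcycle_err L A B P R Minv k *\<^sub>v x) x"
  using assms(2,3)
proof (induction k arbitrary: x rule: inc_induct)
  case base
  interpret hpd_matrix "n L" "B L" using level_facts[of L] by unfold_locales simp
  have "0\<^sub>m (n L) (n L) *\<^sub>v x = 0\<^sub>v (n L)" using base by (intro eq_vecI) auto
  then show ?case using base by (simp add: vcycle_err_top)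
next
  case (step k)
  interpret smoothed_two_level "n k" "B k" "n (Suc k)" "A k" "P k" "R k" "Minv k * A k"
    by (rule level_at[OF step(2)])
  have E: "vcycle_err L A B P R Minv (Suc k) \<in> carrier_mat (n (Suc k)) (n (Suc k))"
    using vcycle_err_carrier[of "Suc k"] step(2) by simp
  show ?case
    unfolding vcycle_err_vec[OF step(2) step(4)]
  proof (rule error_step[OF _ _ _ step(4)])
    show "alpha \<le> ereal a" using a[OF step(2)] by (simp add: alpha_level_eq[OF step(2)])
    show "vcycle_err L A B P R Minv (Suc k) *\<^sub>v w \<in> carrier_vec (n (Suc k))"
      if "w \<in> carrier_vec (n (Suc k))" for w
      by (rule mult_mat_vec_carrier[OF E that])
    show "rip B_c (vcycle_err L A B P R Minv (Suc k) *\<^sub>v w) (vcycle_err L A B P R Minv (Suc k) *\<^sub>v w)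
        \<le> a * rip B_c (vcycle_err L A B P R Minv (Suc k) *\<^sub>v w) w"
      if "w \<in> carrier_vec (n (Suc k))" for w
      using step(3)[OF that] by (simp add: B_Suc[OF step(2)])
  qed
qed

end

section \<open>Convergence of the V-cycle\<close>

theorem corollary4p3:
  fixes L :: nat and n :: "nat \<Rightarrow> nat"
    and A B P R Minv :: "nat \<Rightarrow> complex mat"
  assumes hierarchy: "vcycle_hierarchy L n A B P R Minv"
    and alpha_range: "\<forall>k<L. 0 \<le> alpha_level A B P R Minv k \<and> alpha_level A B P R Minv k < 1"
    and smoother: "\<forall>k<L. mnorm (B k) (1\<^sub>m (n k) - Minv k * A k) < 1"
  shows "(\<forall>k<L. \<forall>e \<in> carrier_vec (n k).
           ereal ((vnorm (B k) ((1\<^sub>m (n k) - adj_wrt (B k) (Minv k * A k)) *\<^sub>v e))\<^sup>2)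
           \<le> alpha_max L A B P R Minv
               * ereal ((vnorm (B k) ((1\<^sub>m (n k) - coarse_proj A P R k) *\<^sub>v e))\<^sup>2)
             + ereal ((vnorm (B k) (coarse_proj A P R k *\<^sub>v e))\<^sup>2))
         \<and> mnorm (B 0) (vcycle_err L A B P R Minv 0) \<le> alpha_max L A B P R Minv
         \<and> alpha_max L A B P R Minv = 1 - 1 / C_V L A B P R Minv"
proof -
  interpret vcycle_hierarchy L n A B P R Minv by (rule hierarchy)
  interpret contracting_vcycle L n A B P R Minv
    using smoother by unfold_locales auto
  define conv where "conv k = (SUP e \<in> {e \<in> carrier_vec (dim_row (A k)). e \<noteq> 0\<^sub>v (dim_row (A k))}.
      ereal ((vnorm (B k) ((id_like (A k) - coarse_proj A P R k) *\<^sub>v (mat_inv (B k) *\<^sub>v e)))\<^sup>2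
             / (vnorm (mhat_inv A B Minv k) e)\<^sup>2))" for k
  have "\<exists>a. 0 \<le> a \<and> a < 1 \<and> alpha_level A B P R Minv k = ereal a
      \<and> conv k = ereal (1 / (1 - a))" if k: "k < L" for k
    using smoothed_two_level.alpha_eq_conv_const[OF level_at[OF k]] alpha_range[rule_format, OF k]
    by (simp add: alpha_level_eq[OF k] conv_const_eq[OF k] conv_def)
  then obtain a where a: "\<And>k. k < L \<Longrightarrow> 0 \<le> a k \<and> a k < 1
      \<and> alpha_level A B P R Minv k = ereal (a k) \<and> conv k = ereal (1 / (1 - a k))"
    by metis
  have ne: "a ` {..<L} \<noteq> {}" using levels by (auto simp: lessThan_empty_iff bot_nat_def)
  \<comment> \<open>A level with the largest \<open>\<alpha>\<^sub>k\<close>. As \<open>1 / (1 - a)\<close> increases with \<open>a\<close>, the maximum that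
      defines \<open>C\<^sub>V\<close> is attained there too.\<close>
  obtain k0 where k0: "k0 < L" "Max (a ` {..<L}) = a k0"
    using Max_in[OF _ ne] by auto
  have le: "a k \<le> a k0" if "k < L" for k
    using that by (simp add: k0(2)[symmetric])
  have amax: "alpha_max L A B P R Minv = ereal (a k0)"
    unfolding alpha_max_def
    by (rule Max_eqI) (use a k0 le in auto)
  have CV: "C_V L A B P R Minv = ereal (1 / (1 - a k0))"
    unfolding C_V_def conv_def[symmetric]
  proof (rule Max_eqI)
    fix y assume "y \<in> conv ` {..<L}"
    then obtain k where k: "k < L" "y = conv k" by auto
    have "1 / (1 - a k) \<le> 1 / (1 - a k0)"
      using le[OF k(1)] a[OF k0(1)] by (intro divide_left_mono) auto
    then show "y \<le> ereal (1 / (1 - a k0))" using a[OF k(1)] k by simp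
  qed (use a[OF k0(1)] k0(1) in \<open>auto intro: image_eqI[of _ _ k0]\<close>)
  have below: "alpha_level A B P R Minv k \<le> ereal (a k0)" if "k < L" for k
    using a[OF that] le[OF that] by simp
  show ?thesis
  proof (intro conjI allI impI ballI)
    fix k and e :: "complex vec" assume k: "k < L" and e: "e \<in> carrier_vec (n k)"
    interpret smoothed_two_level "n k" "B k" "n (Suc k)" "A k" "P k" "R k" "Minv k * A k"
      by (rule level_at[OF k])
    show "ereal ((vnorm (B k) ((1\<^sub>m (n k) - adj_wrt (B k) (Minv k * A k)) *\<^sub>v e))\<^sup>2)
           \<le> alpha_max L A B P R Minv
               * ereal ((vnorm (B k) ((1\<^sub>m (n k) - coarse_proj A P R k) *\<^sub>v e))\<^sup>2)
             + ereal ((vnorm (B k) (coarse_proj A P R k *\<^sub>v e))\<^sup>2)"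
      using smoothing_estimate[OF below[OF k, unfolded alpha_level_eq[OF k]] e] e
      by (simp add: amax residual_vec[OF k] coarse_proj_vec[OF k] S_adj_vec[OF k] vnorm_sq)
  next
    interpret hpd_matrix "n 0" "B 0" by unfold_locales (rule B0_hpd)
    show "mnorm (B 0) (vcycle_err L A B P R Minv 0) \<le> alpha_max L A B P R Minv"
      unfolding amax
    proof (rule mnorm_leI)
      fix x :: "complex vec" assume x: "x \<in> carrier_vec (n 0)"
      show "vnorm (B 0) (vcycle_err L A B P R Minv 0 *\<^sub>v x) \<le> a k0 * vnorm (B 0) x"
        by (rule vnorm_le_of_rip[OF x mult_mat_vec_carrier[OF vcycle_err_carrier x] _
              vcycle_err_estimate[OF below _ x]])
          (use a[OF k0(1)] in auto)
    qed
  next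
    show "alpha_max L A B P R Minv = 1 - 1 / C_V L A B P R Minv"
      using a[OF k0(1)] by (simp add: amax CV one_ereal_def)
  qed
qed

end
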